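(* For infinitely many positive integers $n$ we have $$|\mathrm{Sp}(n;3,1)|\le 2^n-2^{\,n-2^{(1+o(1))\sqrt{\log_2 n}}},$$ where the $o(1)$ term tends to $0$ as $n\to\infty$ along this infinite set of integers $n$.
   Context: $\mathbb{F}_2^n$ is the $n$-dimensional vector space over the field with two elements. A $k$-flat is a $k$-dimensional affine subspace of $\mathbb{F}_2^n$. For a set $S\subseteq\mathbb{F}_2^n$, a $[k,t]$-flat induced by $S$ is a $k$-flat that intersects $S$ in exactly $t$ points; one says $S$ induces a $[k,t]$-flat if such a flat exists. The $(n;k,t)$-spectrum is $$\mathrm{Sp}(n;k,t)=\{m\in\mathbb{Z}: 0\le m\le 2^n,\ \text{every } S\subseteq\mathbb{F}_2^n \text{ with } |S|=m \text{ induces a } [k,t]\text{-flat}\}.$$ *)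

theory Defs
  imports Complex_Main "HOL-Library.Z2" "HOL-Library.Function_Algebras"
begin

definition f2_scale :: "bit \<Rightarrow> (nat \<Rightarrow> bit) \<Rightarrow> (nat \<Rightarrow> bit)" where
  "f2_scale c v = (\<lambda>i. c * v i)"

interpretation f2: vector_space f2_scale
  by unfold_locales (simp_all only: f2_scale_def fun_eq_iff plus_fun_apply distrib_left
    distrib_right mult.assoc mult_1_left simp_thms)

(* A vector of F_2^n is represented by its coordinates 0, ..., n - 1, extended by zero.
   In this way all the spaces F_2^n live in one type and n may vary inside a statement. *)
definition F2_space :: "nat \<Rightarrow> (nat \<Rightarrow> bit) set" where
  "F2_space n = {v. \<forall>i\<ge>n. v i = 0}"

definition is_flat :: "nat \<Rightarrow> nat \<Rightarrow> (nat \<Rightarrow> bit) set \<Rightarrow> bool" where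
  "is_flat n k F \<longleftrightarrow>
     (\<exists>a W. a \<in> F2_space n \<and> W \<subseteq> F2_space n \<and> f2.subspace W \<and> f2.dim W = k \<and>
            F = (\<lambda>w. a + w) ` W)"

definition induces_flat :: "nat \<Rightarrow> nat \<Rightarrow> nat \<Rightarrow> (nat \<Rightarrow> bit) set \<Rightarrow> bool" where
  "induces_flat n k t S \<longleftrightarrow> (\<exists>F. is_flat n k F \<and> card (F \<inter> S) = t)"

definition Sp :: "nat \<Rightarrow> nat \<Rightarrow> nat \<Rightarrow> nat set" where
  "Sp n k t = {m. m \<le> 2 ^ n \<and> (\<forall>S. S \<subseteq> F2_space n \<and> card S = m \<longrightarrow> induces_flat n k t S)}"

end

theory Submission
  imports Defs "HOL-Library.Log_Nat" "HOL-Library.Nat_Bijection" "HOL-Real_Asymp.Real_Asymp"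
begin

text \<open>
  A set \<open>S\<close> induces no \<open>[3,1]\<close>-flat as soon as its complement \<open>T\<close> is the set of common zeros of
  quadratic polynomials over the field with two elements: a polynomial of degree at most two sums
  to zero over a 3-flat, so if it vanishes at seven points of the flat, it vanishes at the eighth
  (\<open>quadric_no_flat_one\<close>). Any number of quadratic equations may be imposed, so it suffices to
  find many sizes of solution sets of quadratic systems. The system built here has a prescribed
  number \<open>\<Sum>i. m i * 2 ^ (b ^ d - 1 - i)\<close> of solutions, for arbitrary bits
  \<open>m i\<close>, \<open>0 < i < b ^ d\<close>, and only \<open>d * d * b\<close> variables more than bits. With \<open>b = 2 ^ d\<close>, the dimension
  \<open>n\<close> is about \<open>2 ^ (d * d)\<close>, and the loss is \<open>2 ^ ((1 + o(1)) * d)\<close>, where \<open>d\<close> is about the square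
  root of the binary logarithm of \<open>n\<close>. There are \<open>2 ^ (b ^ d - 1)\<close> choices of the bits, and they give
  distinct sizes, none of which lies in the spectrum.

  The solution set is to be a disjoint union of subcubes, one for each index \<open>i\<close> with \<open>m i = 1\<close>, of
  codimension \<open>i\<close> in the space of the main variables \<open>X p\<close>, \<open>0 < p < b ^ d\<close>. The index is recorded in code variables
  by its base-\<open>b\<close> digits, each digit in unary: \<open>Z j t c = 1\<close> says that the \<open>t\<close>-th digit is
  \<open>c\<close> and that the leading digit is at position \<open>j\<close>. Two things have to be expressed by equations of
  degree two.

  First, \<open>i\<close> of the main variables must be fixed. The digit \<open>c\<close> at position \<open>l\<close> fixes the
  \<open>c * b ^ l\<close> variables with indices in \<open>{b ^ l..<(c + 1) * b ^ l}\<close>. These blocks are disjoint for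
  different \<open>l\<close>, and setting a variable to zero when a code variable is one is an equation
  of degree two (\<open>kill_eqs\<close>).

  Secondly, \<open>m i = 1\<close> must be enforced. Since \<open>m\<close> is arbitrary, this is a condition of degree \<open>d\<close> in the code,
  and lowering the degree needs auxiliary variables for partial evaluations. They are taken from
  the variables that have to be fixed anyway: if the leading digit of \<open>i\<close> is at position \<open>j\<close>, the
  block \<open>{b ^ j..<2 * b ^ j}\<close> is fixed, and instead of zeros it stores a \<open>b\<close>-ary tree whose
  leaves are the bits \<open>m k\<close>, \<open>b ^ j \<le> k < b ^ Suc j\<close>. As in a heap, the children of node \<open>k\<close>
  are \<open>k * b + c\<close>, and each node copies the child that the corresponding digit selects. So the
  root carries \<open>m i\<close>, and it is required to be one (\<open>heap_eqs\<close>).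
\<close>

text \<open>
  The second derivatives vanish; as \<open>- 1 = 1\<close>, no signs appear.
\<close>

definition affine_fun :: "(('v \<Rightarrow> bit) \<Rightarrow> bit) \<Rightarrow> bool" where
  "affine_fun f \<longleftrightarrow> (\<forall>x a b. f (x + a + b) = f x + f (x + a) + f (x + b))"

text \<open>
  In finitely many variables, the polynomials of degree at most two are the functions whose third
  derivatives vanish; this form of the condition says directly that a value is determined by the seven others on a 3-flat.
\<close>

definition quadratic :: "(('v \<Rightarrow> bit) \<Rightarrow> bit) \<Rightarrow> bool" where
  "quadratic f \<longleftrightarrow> (\<forall>x a b c. f x = f (x + a) + f (x + b) + f (x + c) + f (x + a + b)
     + f (x + a + c) + f (x + b + c) + f (x + a + b + c))"

section \<open>Common zeros of quadratic polynomials\<close>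

(* Addition of bits is kept as field addition; the default simplification turns it into xor. *)
declare add_bit_eq_xor [simp del] mult_bit_eq_and [simp del]

lemma bit_add_self: "x + x = 0" for x :: bit
  by (cases x) simp_all

lemma bit_add_self_left: "x + (x + y) = y" for x y :: bit
  by (cases x; cases y) simp_all

lemma bit_add_eq_0_iff: "x + y = 0 \<longleftrightarrow> x = y" for x y :: bit
  by (cases x; cases y) simp_all

lemma affine_fun_const: "affine_fun (\<lambda>w. c)"
  by (cases c) (simp_all add: affine_fun_def)

lemma affine_fun_coord: "affine_fun (\<lambda>w. w v)"
proof -
  have "p + q + r = p + (p + q) + (p + r)" for p q r :: bit
    by (cases p; cases q; cases r) simp_all
  then show ?thesis by (simp add: affine_fun_def)
qed

lemma affine_fun_sum:
  assumes "\<And>i. i \<in> I \<Longrightarrow> affine_fun (f i)"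
  shows "affine_fun (\<lambda>w. \<Sum>i\<in>I. f i w)"
  using assms by (simp add: affine_fun_def sum.distrib[symmetric] del: add_bit_eq_xor)

lemma quadratic_add:
  assumes "quadratic f" "quadratic g"
  shows "quadratic (\<lambda>w. f w + g w)"
  unfolding quadratic_def
proof (intro allI)
  fix x a b c
  show "f x + g x = f (x + a) + g (x + a) + (f (x + b) + g (x + b)) + (f (x + c) + g (x + c))
     + (f (x + a + b) + g (x + a + b)) + (f (x + a + c) + g (x + a + c))
     + (f (x + b + c) + g (x + b + c)) + (f (x + a + b + c) + g (x + a + b + c))"
    using assms[unfolded quadratic_def, rule_format, of x a b c] by (simp only: ac_simps)
qed

lemma quadratic_sum:
  assumes "\<And>i. i \<in> I \<Longrightarrow> quadratic (f i)"
  shows "quadratic (\<lambda>w. \<Sum>i\<in>I. f i w)"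
  unfolding quadratic_def
proof (intro allI)
  fix x a b c
  have "(\<Sum>i\<in>I. f i x) = (\<Sum>i\<in>I. f i (x + a) + f i (x + b) + f i (x + c) + f i (x + a + b)
     + f i (x + a + c) + f i (x + b + c) + f i (x + a + b + c))"
    using assms unfolding quadratic_def by (intro sum.cong) blast+
  then show "(\<Sum>i\<in>I. f i x) = (\<Sum>i\<in>I. f i (x + a)) + (\<Sum>i\<in>I. f i (x + b)) + (\<Sum>i\<in>I. f i (x + c))
     + (\<Sum>i\<in>I. f i (x + a + b)) + (\<Sum>i\<in>I. f i (x + a + c)) + (\<Sum>i\<in>I. f i (x + b + c))
     + (\<Sum>i\<in>I. f i (x + a + b + c))"
    by (simp only: sum.distrib)
qed

text \<open>
  The values of two affine functions on a cube are determined by those at a corner (\<open>p\<close>, \<open>q\<close>) and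
  at its three neighbours. This identity is the vanishing of the third derivative of their product.
\<close>

lemma bit_product_identity:
  fixes p a b c q a' b' c' :: bit
  shows "p * q = a * a' + b * b' + c * c' + (p + a + b) * (q + a' + b') + (p + a + c) * (q + a' + c')
    + (p + b + c) * (q + b' + c') + (a + b + c) * (a' + b' + c')"
  by (cases p; cases q; cases a; cases a'; cases b; cases b'; simp add: bit_add_self bit_add_self_left; cases c; cases c'; simp)

lemma quadratic_mult:
  fixes f g :: "('v \<Rightarrow> bit) \<Rightarrow> bit"
  assumes "affine_fun f" "affine_fun g"
  shows "quadratic (\<lambda>w. f w * g w)"
  unfolding quadratic_def
proof (intro allI)
  fix x a b c :: "'v \<Rightarrow> bit"
  have aff: "h (x + a + b + c) = h (x + a) + h (x + b) + h (x + c)"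
    "h (x + a + b) = h x + h (x + a) + h (x + b)" "h (x + a + c) = h x + h (x + a) + h (x + c)"
    "h (x + b + c) = h x + h (x + b) + h (x + c)"
    if "affine_fun h" for h :: "('v \<Rightarrow> bit) \<Rightarrow> bit"
  proof -
    note A = that[unfolded affine_fun_def, rule_format]
    show "h (x + a + b) = h x + h (x + a) + h (x + b)" "h (x + a + c) = h x + h (x + a) + h (x + c)"
      "h (x + b + c) = h x + h (x + b) + h (x + c)" by (fact A)+
    have "h (x + a + b + c) = h (x + a) + h (x + a + b) + h (x + a + c)" by (rule A)
    then show "h (x + a + b + c) = h (x + a) + h (x + b) + h (x + c)"
      unfolding A[of x a b] A[of x a c] by (simp only: ac_simps bit_add_self_left)
  qed
  show "f x * g x = f (x + a) * g (x + a) + f (x + b) * g (x + b) + f (x + c) * g (x + c)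
     + f (x + a + b) * g (x + a + b) + f (x + a + c) * g (x + a + c) + f (x + b + c) * g (x + b + c)
     + f (x + a + b + c) * g (x + a + b + c)"
    unfolding aff[OF assms(1)] aff[OF assms(2)]
    by (rule bit_product_identity)
qed

lemma quadratic_affine: "affine_fun f \<Longrightarrow> quadratic f"
  using quadratic_mult[OF _ affine_fun_const[of 1], of f] by simp

definition quadric :: "('v \<Rightarrow> bit) set \<Rightarrow> bool" where
  "quadric T \<longleftrightarrow> (\<exists>Q. (\<forall>q\<in>Q. quadratic q) \<and> T = {w. \<forall>q\<in>Q. q w = 0})"

lemma quadric_eq:
  assumes "quadratic f" "quadratic g"
  shows "quadric {w. f w = g w}"
  unfolding quadric_def
  by (rule exI[of _ "{\<lambda>w. f w + g w}"]) (simp add: quadratic_add assms bit_add_eq_0_iff del: add_bit_eq_xor)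

lemma quadric_ALL:
  assumes "\<And>i. i \<in> I \<Longrightarrow> quadric {w. P i w}"
  shows "quadric {w. \<forall>i\<in>I. P i w}"
proof -
  have "\<forall>i\<in>I. \<exists>Q. (\<forall>q\<in>Q. quadratic q) \<and> {w. P i w} = {w. \<forall>q\<in>Q. q w = 0}"
    using assms unfolding quadric_def by blast
  then obtain Q where
    Q: "\<forall>i\<in>I. (\<forall>q\<in>Q i. quadratic q) \<and> {w. P i w} = {w. \<forall>q\<in>Q i. q w = 0}"
    by (rule bchoice[THEN exE])
  show ?thesis unfolding quadric_def
  proof (intro exI conjI)
    show "\<forall>q\<in>(\<Union>i\<in>I. Q i). quadratic q" using Q by blast
    have "P i w \<longleftrightarrow> (\<forall>q\<in>Q i. q w = 0)" if "i \<in> I" for i w using Q that by blast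
    then show "{w. \<forall>i\<in>I. P i w} = {w. \<forall>q\<in>(\<Union>i\<in>I. Q i). q w = 0}" by auto
  qed
qed

lemma quadric_conj:
  assumes "quadric {w. P w}" "quadric {w. R w}"
  shows "quadric {w. P w \<and> R w}"
proof -
  \<comment> \<open>A conjunction is a universal quantification over two cases.\<close>
  have "quadric {w. \<forall>i\<in>{True, False}. if i then P w else R w}"
  proof (rule quadric_ALL)
    show "quadric {w. if i then P w else R w}" for i
      using assms by (cases i) simp_all
  qed
  then show ?thesis by (simp only: ball_simps if_True if_False simp_thms)
qed

text \<open>
  If the flat met the complement of \<open>T\<close> in the point \<open>x\<close> only, the seven other points \<open>x + u\<close>, with
  \<open>u\<close> a nonzero sum of basis vectors of the direction space, would lie in \<open>T\<close>. The defining
  polynomials vanish at these seven points, hence at \<open>x\<close>, which would be in \<open>T\<close> too.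
\<close>

lemma quadric_no_flat_one:
  assumes "quadric T"
  shows "\<not> induces_flat n 3 1 (F2_space n - T)"
proof
  assume "induces_flat n 3 1 (F2_space n - T)"
  then obtain p W where p: "p \<in> F2_space n" and W: "W \<subseteq> F2_space n" "f2.subspace W" "f2.dim W = 3"
    and one: "card ((\<lambda>w. p + w) ` W \<inter> (F2_space n - T)) = 1"
    unfolding induces_flat_def is_flat_def by blast
  from one obtain x where x: "(\<lambda>w. p + w) ` W \<inter> (F2_space n - T) = {x}"
    by (auto simp: card_1_singleton_iff)
  then obtain w0 where w0: "w0 \<in> W" "x = p + w0" by blast
  have xT: "x \<notin> T" and x_space: "x \<in> F2_space n" using x by blast+
  obtain B where B: "B \<subseteq> W" "f2.independent B" "card B = 3"
    using f2.basis_exists[of W] W(3) by metis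
  then obtain a b c where abc: "B = {a, b, c}" "a \<noteq> b" "a \<noteq> c" "b \<noteq> c"
    by (auto simp: card_3_iff)
  have eqI: "u = v" if "u + v = 0" for u v :: "nat \<Rightarrow> bit"
  proof
    fix i show "u i = v i"
      using fun_cong[OF that, of i] bit_add_eq_0_iff[of "u i" "v i"]
      by (simp only: plus_fun_apply zero_fun_apply)
  qed
  have span: "c \<notin> f2.span {a, b}" "b \<notin> f2.span {a}" "a \<notin> f2.span {}"
  proof -
    have *: "v \<notin> f2.span A" if "v \<in> B" "A \<subseteq> B - {v}" for v A
      using B(2) f2.span_mono[OF that(2)] that(1) unfolding f2.dependent_def by blast
    show "c \<notin> f2.span {a, b}" "b \<notin> f2.span {a}" "a \<notin> f2.span {}"
      by (rule *; use abc in auto)+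
  qed
  have nz': "u \<noteq> 0" if "u \<in> {a, b, c, a + b, a + c, b + c, a + b + c}" for u
  proof
    assume "u = 0"
    have "a \<noteq> 0" "b \<noteq> 0" "c \<noteq> 0"
      using span f2.span_zero by metis+
    moreover have "a + b \<noteq> 0" using eqI[of a b] abc(2) by blast
    moreover have "a + c \<noteq> 0" using eqI[of a c] abc(3) by blast
    moreover have "b + c \<noteq> 0" using eqI[of b c] abc(4) by blast
    moreover have "a + b \<in> f2.span {a, b}" by (intro f2.span_add f2.span_base) simp_all
    then have "a + b + c \<noteq> 0" using eqI[of "a + b" c] span(1) by metis
    ultimately show False using that \<open>u = 0\<close> by blast
  qed
  have in_W: "u \<in> W" if "u \<in> {a, b, c, a + b, a + c, b + c, a + b + c}" for u
  proof -
    have single: "a \<in> W" "b \<in> W" "c \<in> W" using B(1) abc(1) by auto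
    moreover from this have "a + b \<in> W" "a + c \<in> W" "b + c \<in> W"
      using f2.subspace_add[OF W(2)] by metis+
    moreover from this have "a + b + c \<in> W"
      using f2.subspace_add[OF W(2), of "a + b" c] single by blast
    ultimately show ?thesis using that by (elim insertE emptyE) (simp_all only:)
  qed
  have "x + u \<in> T" if "u \<in> {a, b, c, a + b, a + c, b + c, a + b + c}" for u
  proof (rule ccontr)
    assume "x + u \<notin> T"
    moreover have "x + u \<in> (\<lambda>w. p + w) ` W"
    proof (rule image_eqI)
      show "x + u = p + (w0 + u)" using w0(2) by (simp only: add.assoc)
      show "w0 + u \<in> W" by (rule f2.subspace_add[OF W(2) w0(1) in_W[OF that]])
    qed
    moreover have "x + u \<in> F2_space n"
      using subsetD[OF W(1) in_W[OF that]] x_space by (simp add: F2_space_def)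
    ultimately have "x + u \<in> (\<lambda>w. p + w) ` W \<inter> (F2_space n - T)" by (intro IntI DiffI)
    then have "x + u = x" unfolding x by (simp only: singleton_iff)
    then show False using nz'[OF that] by (simp only: add_cancel_left_right)
  qed
  then have x_cube: "x + a \<in> T" "x + b \<in> T" "x + c \<in> T" "x + a + b \<in> T" "x + a + c \<in> T"
    "x + b + c \<in> T" "x + a + b + c \<in> T"
    by (simp_all only: add.assoc insertI1 insertI2)
  obtain Q where Q: "\<forall>q\<in>Q. quadratic q" "T = {w. \<forall>q\<in>Q. q w = 0}"
    using assms unfolding quadric_def by blast
  have "q x = 0" if "q \<in> Q" for q
  proof -
    have "quadratic q" and zero: "\<And>y. y \<in> T \<Longrightarrow> q y = 0" using Q that by blast+
    then have "q x = q (x + a) + q (x + b) + q (x + c) + q (x + a + b) + q (x + a + c)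
      + q (x + b + c) + q (x + a + b + c)"
      unfolding quadratic_def by blast
    then show ?thesis using x_cube by (simp only: zero add_0_left)
  qed
  then show False using xT Q(2) by blast
qed

lemma card_subcube:
  assumes "finite V" "D \<subseteq> V"
  shows "card {w :: 'v \<Rightarrow> bit. (\<forall>v. v \<notin> V \<longrightarrow> w v = 0) \<and> (\<forall>v\<in>D. w v = g v)} = 2 ^ (card V - card D)"
    (is "card ?C = _")
proof -
  \<comment> \<open>A point of the subcube is given by the set of free coordinates that are one.\<close>
  have "bij_betw (\<lambda>w. {v \<in> V - D. w v = 1}) ?C (Pow (V - D))"
  proof (rule bij_betw_byWitness[where f' = "\<lambda>A v. if v \<in> D then g v else of_bool (v \<in> A)"], goal_cases)
    case 1
    show ?case
    proof (intro ballI ext)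
      fix w v assume "w \<in> ?C"
      then show "(if v \<in> D then g v else of_bool (v \<in> {v \<in> V - D. w v = 1})) = w v"
        by (cases "w v") auto
    qed
  next
    case 2
    show ?case using assms(2) by (auto split: if_splits)
  next
    case 3
    show ?case by auto
  next
    case 4
    show ?case using assms(2) by auto
  qed
  then have "card ?C = card (Pow (V - D))" by (rule bij_betw_same_card)
  also have "\<dots> = 2 ^ (card V - card D)"
    using assms by (simp add: card_Pow card_Diff_subset finite_subset)
  finally show ?thesis .
qed

lemma card_F2_space: "card (F2_space n) = 2 ^ n"
  using card_subcube[of "{..<n}" "{}"] by (simp add: F2_space_def not_less)

text \<open>
  The coordinates may be labelled by any finite set \<open>V\<close>, since composing a
  quadratic polynomial with a relabelling of the coordinates leaves it quadratic.
\<close>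

lemma not_in_Sp:
  fixes T :: "('v \<Rightarrow> bit) set"
  assumes "finite V" "card V = n" and T: "quadric T" "T \<subseteq> {w. \<forall>v. v \<notin> V \<longrightarrow> w v = 0}"
  shows "2 ^ n - card T \<notin> Sp n 3 1"
proof -
  obtain h where h: "bij_betw h V {..<n}"
    using assms(1,2) by (metis card_lessThan finite_lessThan finite_same_card_bij)
  define g :: "(nat \<Rightarrow> bit) \<Rightarrow> 'v \<Rightarrow> bit" where "g u = (\<lambda>v. if v \<in> V then u (h v) else 0)" for u
  have g_add: "g (u + u') = g u + g u'" for u u' by (auto simp: g_def)
  have "quadratic (\<lambda>u. q (g u))" if "quadratic q" for q
    using that by (simp add: quadratic_def g_add)
  moreover obtain Q where "\<forall>q\<in>Q. quadratic q" "T = {w. \<forall>q\<in>Q. q w = 0}"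
    using T(1) unfolding quadric_def by blast
  ultimately have "quadric {u. g u \<in> T}"
    unfolding quadric_def by (intro exI[of _ "(\<lambda>q u. q (g u)) ` Q"]) auto
  then have "\<not> induces_flat n 3 1 (F2_space n - {u. g u \<in> T})" by (rule quadric_no_flat_one)
  moreover have "card (F2_space n - {u. g u \<in> T}) = 2 ^ n - card T"
  proof -
    have hV: "h v < n" if "v \<in> V" for v using h that by (auto simp: bij_betw_def)
    have hinv: "inv_into V h i \<in> V" "h (inv_into V h i) = i" if "i < n" for i
      using h that by (auto simp: bij_betw_def intro!: inv_into_into f_inv_into_f)
    have hinv': "inv_into V h (h v) = v" if "v \<in> V" for v
      using h that by (auto simp: bij_betw_def intro!: inv_into_f_f)
      \<comment> \<open>The inverse of \<open>g\<close>, extended by zero.\<close>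
  define k :: "('v \<Rightarrow> bit) \<Rightarrow> nat \<Rightarrow> bit"
      where "k w = (\<lambda>i. if i < n then w (inv_into V h i) else 0)" for w
    have "bij_betw g (F2_space n \<inter> {u. g u \<in> T}) T"
    proof (rule bij_betw_byWitness[where f' = k])
      show "\<forall>w\<in>T. g (k w) = w"
      proof (intro ballI ext)
        fix w v assume "w \<in> T"
        then show "g (k w) v = w v"
          using T(2) hV[of v] hinv'[of v] by (auto simp: g_def k_def)
      qed
      then show "k ` T \<subseteq> F2_space n \<inter> {u. g u \<in> T}"
        by (auto simp: k_def F2_space_def)
    qed (use hinv in \<open>auto simp: g_def k_def F2_space_def fun_eq_iff\<close>)
    then have "card (F2_space n \<inter> {u. g u \<in> T}) = card T" by (rule bij_betw_same_card)
    moreover have "finite (F2_space n)" by (rule card_ge_0_finite) (simp add: card_F2_space)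
    ultimately show ?thesis by (simp add: card_Diff_subset_Int card_F2_space)
  qed
  ultimately show ?thesis unfolding Sp_def by (metis (mono_tags, lifting) Diff_subset mem_Collect_eq)
qed

section \<open>Base-b digits and their unary code\<close>

text \<open>
  \<open>X p\<close> are the main variables; \<open>Z j t c\<close> is one if the encoded number has its leading digit at
  position \<open>j\<close> and its \<open>t\<close>-th digit is \<open>c\<close>.
\<close>

datatype var = X nat | Z nat nat nat

lemma one_hot:
  fixes f :: "nat \<Rightarrow> bit"
  assumes "\<And>c c'. c < b \<Longrightarrow> c' < b \<Longrightarrow> c \<noteq> c' \<Longrightarrow> f c * f c' = 0" "(\<Sum>c<b. f c) = 1"
  shows "\<exists>c<b. \<forall>c'<b. f c' = of_bool (c' = c)"
proof -
  obtain c where c: "c < b" "f c \<noteq> 0" using assms(2) by (metis lessThan_iff sum.neutral zero_neq_one)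
  have "f c' = of_bool (c' = c)" if "c' < b" for c'
    using assms(1)[OF c(1) that] c(2) by (cases "c' = c") simp_all
  with c(1) show ?thesis by blast
qed

lemma all_zero_if_sum_zero:
  fixes f :: "nat \<Rightarrow> bit"
  assumes "\<And>c c'. c < b \<Longrightarrow> c' < b \<Longrightarrow> c \<noteq> c' \<Longrightarrow> f c * f c' = 0" "(\<Sum>c<b. f c) = 0" "c < b"
  shows "f c = 0"
proof (rule ccontr)
  assume "f c \<noteq> 0"
  then have "f c' = 0" if "c' < b" "c' \<noteq> c" for c'
    using assms(1)[OF that(1) assms(3) that(2)] by simp
  then have "(\<Sum>c<b. f c) = (\<Sum>c'\<in>{c}. f c')"
    using assms(3) by (intro sum.mono_neutral_right) auto
  with \<open>f c \<noteq> 0\<close> assms(2) show False by simp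
qed

lemma sum_of_bool_eq:
  "(\<Sum>c<(b::nat). of_bool (P \<and> c = k) :: bit) = of_bool (P \<and> k < b)"
proof (cases "P \<and> k < b")
  case True
  then have "(\<Sum>c<b. of_bool (P \<and> c = k) :: bit) = (\<Sum>c\<in>{k}. of_bool (P \<and> c = k))"
    by (intro sum.mono_neutral_right) auto
  with True show ?thesis by simp
next
  case False
  then have "of_bool (P \<and> c = k) = (0 :: bit)" if "c < b" for c using that by auto
  then have "(\<Sum>c<b. of_bool (P \<and> c = k) :: bit) = (\<Sum>c<b. 0)" by (intro sum.cong) auto
  with False show ?thesis by (simp only: sum.neutral_const of_bool_eq)
qed

text \<open>
  The set of the numbers below the one with binary digits \<open>m\<close>, \<open>m 1\<close> being the most significant,
  splits into pieces of the sizes \<open>2 ^ (b ^ d - 1 - i)\<close> with \<open>m i = 1\<close>: a smaller number agrees with \<open>m\<close> up to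
  some place \<open>i\<close> with \<open>m i = 1\<close>, has a zero there, and is arbitrary afterwards. The solutions of the
  system form pieces of the same sizes.
\<close>

locale comparator =
  fixes b d :: nat and m :: "nat \<Rightarrow> bit"
  assumes base: "2 \<le> b"
begin

definition digit :: "nat \<Rightarrow> nat \<Rightarrow> nat" where
  "digit i t = i div b ^ t mod b"

abbreviation len :: "nat \<Rightarrow> nat" where
  "len i \<equiv> floorlog b i"

lemma digit_less: "digit i t < b"
  using base by (simp add: digit_def)

lemma sum_digits: "(\<Sum>t<n. digit i t * b ^ t) = i mod b ^ n"
proof (induction n)
  case (Suc n)
  have "i mod (b ^ n * b) = b ^ n * (i div b ^ n mod b) + i mod b ^ n" by (rule mod_mult2_eq)
  with Suc show ?case by (simp add: digit_def mult.commute)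
qed simp

lemma digits_exist:
  assumes "\<And>t. t < n \<Longrightarrow> f t < b"
  shows "\<exists>i<b ^ n. \<forall>t<n. digit i t = f t"
  using assms
proof (induction n arbitrary: f)
  case (Suc n)
  from Suc.IH[of "\<lambda>t. f (Suc t)"] Suc.prems obtain i
    where i: "i < b ^ n" "\<forall>t<n. digit i t = f (Suc t)" by auto
  have f0: "f 0 < b" using Suc.prems by simp
  have "f 0 + b * i < b ^ Suc n"
  proof -
    have "b * (i + 1) \<le> b * b ^ n" using i(1) by (intro mult_le_mono2) simp
    then show ?thesis using f0 by simp
  qed
  moreover have "digit (f 0 + b * i) t = f t" if "t < Suc n" for t
  proof (cases t)
    case (Suc t')
    have "(f 0 + b * i) div (b * b ^ t') = i div b ^ t'"
      using f0 by (simp add: div_mult2_eq)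
    with i(2) that Suc show ?thesis by (simp add: digit_def)
  qed (use f0 in \<open>simp add: digit_def\<close>)
  ultimately show ?case by blast
qed simp

lemma len_eqI:
  assumes "b ^ j \<le> i" "i < b ^ Suc j"
  shows "len i = Suc j"
proof (rule antisym)
  show "len i \<le> Suc j" using assms(2) base by (intro floorlog_leI) auto
  show "Suc j \<le> len i" using assms(1) base by (intro floorlog_ge_SucI) auto
qed

lemma len_bounds:
  assumes "len i = Suc j"
  shows "b ^ j \<le> i" "i < b ^ Suc j"
proof -
  have "i \<noteq> 0" using assms by (metis compute_floorlog less_nat_zero_code nat.distinct(1))
  then have "b ^ (len i - 1) \<le> i \<and> i < b ^ len i"
    using base by (intro floorlog_bounds) auto
  then show "b ^ j \<le> i" "i < b ^ Suc j" unfolding assms by simp_all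
qed

lemma lead_digit:
  assumes "len i = Suc j"
  shows "0 < digit i j"
proof -
  have "0 < i div b ^ j" "i div b ^ j < b"
    using len_bounds[OF assms] base by (simp_all add: div_greater_zero_iff less_mult_imp_div_less mult.commute)
  then show ?thesis by (simp add: digit_def)
qed

lemma digit_beyond:
  assumes "len i = Suc j" "j < t"
  shows "digit i t = 0"
proof -
  have "i < b ^ Suc j" by (rule len_bounds[OF assms(1)])
  also have "\<dots> \<le> b ^ t" using assms(2) base by (intro power_increasing) auto
  finally show ?thesis by (simp add: digit_def)
qed

lemma len_cases:
  assumes "i \<in> {1..<b ^ d}"
  obtains j where "j < d" "len i = Suc j"
proof -
  have "len i \<noteq> 0" using assms base by (auto simp only: floorlog_eq_zero_iff atLeastLessThan_iff)
  moreover have "len i \<le> d" using assms base by (intro floorlog_leI) auto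
  ultimately show ?thesis by (intro that[of "len i - 1"]) linarith+
qed

lemma len_child:
  assumes "c < b" "k * b + c \<noteq> 0"
  shows "len (k * b + c) = Suc (len k)"
  using assms base by (subst compute_floorlog) simp

definition vars :: "var set" where
  "vars = X ` {1..<b ^ d} \<union> (\<lambda>(j, t, c). Z j t c) ` ({..<d} \<times> {..<d} \<times> {..<b})"

lemma card_code_vars: "card ((\<lambda>(j, t, c). Z j t c) ` ({..<d} \<times> {..<d} \<times> {..<b})) = d * (d * b)"
  by (subst card_image) (auto simp: inj_on_def card_cartesian_product)

lemma finite_vars: "finite vars"
  by (simp add: vars_def)

lemma card_vars: "card vars = b ^ d - 1 + d * (d * b)"
proof -
  have "card (X ` {1..<b ^ d}) = b ^ d - 1"
    by (subst card_image) (auto simp: inj_on_def)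
  then show ?thesis
    unfolding vars_def by (subst card_Un_disjoint) (auto simp: card_code_vars)
qed

text \<open>
  In a code word exactly one of the families \<open>Z j\<close> of code variables is in use; \<open>sel w j\<close> tells if
  it is the \<open>j\<close>-th. As a sum of variables it is linear, so it can multiply a main variable.
\<close>

definition sel :: "(var \<Rightarrow> bit) \<Rightarrow> nat \<Rightarrow> bit" where
  "sel w j = (\<Sum>c<b. w (Z j 0 c))"

definition encodes :: "(var \<Rightarrow> bit) \<Rightarrow> nat \<Rightarrow> bool" where
  "encodes w i \<longleftrightarrow> (\<forall>j<d. \<forall>t<d. \<forall>c<b. w (Z j t c) = of_bool (len i = Suc j \<and> c = digit i t))"

definition code_eqs :: "(var \<Rightarrow> bit) \<Rightarrow> bool" where
  "code_eqs w \<longleftrightarrow>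
     (\<forall>j\<in>{..<d}. \<forall>t\<in>{..<d}. (\<Sum>c<b. w (Z j t c)) = sel w j) \<and>
     (\<forall>j\<in>{..<d}. \<forall>t\<in>{..<d}. \<forall>c\<in>{..<b}. \<forall>c'\<in>{..<b} - {c}. w (Z j t c) * w (Z j t c') = 0) \<and>
     (\<Sum>j<d. sel w j) = 1 \<and>
     (\<forall>j\<in>{..<d}. \<forall>j'\<in>{..<d} - {j}. sel w j * sel w j' = 0) \<and>
     (\<forall>j\<in>{..<d}. \<forall>t\<in>{j<..<d}. w (Z j t 0) = sel w j) \<and>
     (\<forall>j\<in>{..<d}. w (Z j j 0) = 0)"

lemma encodes_sel:
  assumes "encodes w i" "j < d"
  shows "sel w j = of_bool (len i = Suc j)"
proof -
  have "sel w j = (\<Sum>c<b. of_bool (len i = Suc j \<and> c = digit i 0))"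
    using assms unfolding sel_def encodes_def by (intro sum.cong) auto
  then show ?thesis by (simp only: sum_of_bool_eq digit_less simp_thms)
qed

lemma encodes_sum:
  assumes "encodes w i" "j < d" "t < d"
  shows "(\<Sum>c<b. w (Z j t c)) = of_bool (len i = Suc j)"
proof -
  have "(\<Sum>c<b. w (Z j t c)) = (\<Sum>c<b. of_bool (len i = Suc j \<and> c = digit i t))"
    using assms unfolding encodes_def by (intro sum.cong) auto
  then show ?thesis by (simp only: sum_of_bool_eq digit_less simp_thms)
qed

text \<open>
  The first two groups of equations say that each digit of the family \<open>j\<close> has exactly one value if
  \<open>j\<close> is selected and none otherwise; the next two select one family; the last two say that the
  digits beyond position \<open>j\<close> vanish and that the one at position \<open>j\<close> does not.
\<close>

lemma code_eqs_iff: "code_eqs w \<longleftrightarrow> (\<exists>i\<in>{1..<b ^ d}. encodes w i)"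
proof
  assume eqs: "code_eqs w"
  have sum_eq: "(\<Sum>c<b. w (Z j t c)) = sel w j" if "j < d" "t < d" for j t
    using eqs that unfolding code_eqs_def by blast
  have orth: "w (Z j t c) * w (Z j t c') = 0" if "j < d" "t < d" "c < b" "c' < b" "c \<noteq> c'" for j t c c'
    using eqs that unfolding code_eqs_def by blast
  have sel_orth: "sel w j * sel w j' = 0" if "j < d" "j' < d" "j \<noteq> j'" for j j'
    using eqs that unfolding code_eqs_def by blast
  have "(\<Sum>j<d. sel w j) = 1" using eqs unfolding code_eqs_def by blast
  with one_hot[of d "sel w"] sel_orth
  have "\<exists>j<d. \<forall>j'<d. sel w j' = of_bool (j' = j)" by blast
  then obtain j where j: "j < d" "\<And>j'. j' < d \<Longrightarrow> sel w j' = of_bool (j' = j)" by blast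
  have "\<forall>t\<in>{..<d}. \<exists>c. c < b \<and> (\<forall>c'<b. w (Z j t c') = of_bool (c' = c))"
  proof
    fix t assume "t \<in> {..<d}"
    then have t: "t < d" by simp
    have "(\<Sum>c<b. w (Z j t c)) = 1" using sum_eq[OF j(1) t] j by simp
    with one_hot[of b "\<lambda>c. w (Z j t c)"] orth[OF j(1) t]
    show "\<exists>c. c < b \<and> (\<forall>c'<b. w (Z j t c') = of_bool (c' = c))" by blast
  qed
  then obtain f where "\<forall>t\<in>{..<d}. f t < b \<and> (\<forall>c'<b. w (Z j t c') = of_bool (c' = f t))"
    by (rule bchoice[THEN exE])
  then have f: "\<And>t. t < d \<Longrightarrow> f t < b"
    "\<And>t c. t < d \<Longrightarrow> c < b \<Longrightarrow> w (Z j t c) = of_bool (c = f t)" by simp_all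
  obtain i where i: "i < b ^ d" "\<And>t. t < d \<Longrightarrow> digit i t = f t"
    using digits_exist[of d f] f(1) by blast
  have zero: "digit i t = 0" if "j < t" "t < d" for t
  proof -
    have "w (Z j t 0) = sel w j"
      using eqs that j(1) unfolding code_eqs_def by (meson greaterThanLessThan_iff lessThan_iff)
    then show ?thesis using j f(2)[OF that(2), of 0] i(2)[OF that(2)] base by (cases "f t = 0") simp_all
  qed
  have nonzero: "digit i j \<noteq> 0"
  proof -
    have "w (Z j j 0) = 0" using eqs j(1) unfolding code_eqs_def by blast
    then show ?thesis using f(2)[OF j(1), of 0] i(2)[OF j(1)] base by (cases "f j = 0") simp_all
  qed
  \<comment> \<open>The leading digit of \<open>i\<close> is at position \<open>j\<close> because of the last two groups of equations.\<close>
  have "i = (\<Sum>t<d. digit i t * b ^ t)" using i(1) by (simp add: sum_digits)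
  also have "\<dots> = (\<Sum>t<Suc j. digit i t * b ^ t)"
    using j(1) zero by (intro sum.mono_neutral_right) auto
  finally have i_sum: "i = (\<Sum>t<Suc j. digit i t * b ^ t)" .
  have len: "len i = Suc j"
  proof (rule len_eqI)
    have "1 * b ^ j \<le> digit i j * b ^ j" using nonzero by (intro mult_le_mono1) simp
    also have "\<dots> \<le> (\<Sum>t<Suc j. digit i t * b ^ t)" by (intro member_le_sum) auto
    finally show "b ^ j \<le> i" using i_sum by simp
    have "i mod b ^ Suc j < b ^ Suc j" using base by (intro mod_less_divisor) simp
    then show "i < b ^ Suc j" using i_sum by (simp only: sum_digits)
  qed
  then have "i \<noteq> 0" by (metis compute_floorlog less_nat_zero_code nat.distinct(1))
  moreover have "encodes w i" unfolding encodes_def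
  proof (intro allI impI)
    fix j' t c assume lt: "j' < d" "t < d" "c < b"
    show "w (Z j' t c) = of_bool (len i = Suc j' \<and> c = digit i t)"
    proof (cases "j' = j")
      case True
      then show ?thesis using lt f i len by simp
    next
      case False
      then have "(\<Sum>c<b. w (Z j' t c)) = 0" using sum_eq[OF lt(1,2)] j(2)[OF lt(1)] by simp
      with all_zero_if_sum_zero[of b "\<lambda>c. w (Z j' t c)" c] orth[OF lt(1,2)] lt(3)
      have "w (Z j' t c) = 0" by blast
      then show ?thesis using False len by simp
    qed
  qed
  ultimately show "\<exists>i\<in>{1..<b ^ d}. encodes w i" using i(1) by (intro bexI[of _ i]) auto
next
  assume "\<exists>i\<in>{1..<b ^ d}. encodes w i"
  then obtain i where i: "i \<in> {1..<b ^ d}" and enc: "encodes w i" by blast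
  obtain j where j: "j < d" "len i = Suc j" using len_cases[OF i] .
  have "(\<Sum>j'<d. sel w j') = (\<Sum>j'<d. of_bool (True \<and> j' = j))"
    using encodes_sel[OF enc] j by (intro sum.cong) auto
  also have "\<dots> = of_bool (True \<and> j < d)" by (rule sum_of_bool_eq)
  finally have one: "(\<Sum>j<d. sel w j) = 1" using j(1) by simp
  have code: "w (Z j' t c) = of_bool (len i = Suc j' \<and> c = digit i t)"
    if "j' < d" "t < d" "c < b" for j' t c
    using enc that unfolding encodes_def by blast
  show "code_eqs w" unfolding code_eqs_def
  proof (intro conjI ballI)
    fix j' t assume "j' \<in> {..<d}" "t \<in> {..<d}"
    then show "(\<Sum>c<b. w (Z j' t c)) = sel w j'"
      by (simp only: lessThan_iff encodes_sum[OF enc] encodes_sel[OF enc])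
  next
    fix j' t c c' assume "j' \<in> {..<d}" "t \<in> {..<d}" "c \<in> {..<b}" "c' \<in> {..<b} - {c}"
    then show "w (Z j' t c) * w (Z j' t c') = 0"
      by (auto simp: code)
  next
    show "(\<Sum>j<d. sel w j) = 1" by (fact one)
  next
    fix j1 j2 assume "j1 \<in> {..<d}" "j2 \<in> {..<d} - {j1}"
    then show "sel w j1 * sel w j2 = 0"
      by (auto simp: encodes_sel[OF enc] j(2))
  next
    fix j' t assume "j' \<in> {..<d}" "t \<in> {j'<..<d}"
    then show "w (Z j' t 0) = sel w j'"
      using base digit_beyond[of i j' t] by (auto simp: encodes_sel[OF enc] code)
  next
    fix j' assume "j' \<in> {..<d}"
    then show "w (Z j' j' 0) = 0"
      using base lead_digit[of i j'] by (auto simp: code)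
  qed
qed

lemma encodes_inj:
  assumes "encodes w i" "encodes w i'" "i \<in> {1..<b ^ d}" "i' \<in> {1..<b ^ d}"
  shows "i = i'"
proof -
  obtain j where j: "j < d" "len i = Suc j" using len_cases[OF assms(3)] .
  have "digit i t = digit i' t" if "t < d" for t
  proof -
    have "w (Z j t (digit i t)) = 1" "w (Z j t (digit i t)) = of_bool (len i' = Suc j \<and> digit i t = digit i' t)"
      using assms(1,2) j that digit_less unfolding encodes_def by simp_all
    then show ?thesis by (cases "digit i t = digit i' t") simp_all
  qed
  then have "(\<Sum>t<d. digit i t * b ^ t) = (\<Sum>t<d. digit i' t * b ^ t)" by simp
  then show ?thesis using assms(3,4) by (simp add: sum_digits)
qed

section \<open>The quadratic system\<close>

text \<open>
  The indices of the main variables that are fixed when the encoded number is \<open>i\<close>: a digit \<open>c\<close> at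
  position \<open>l\<close> contributes \<open>c * b ^ l\<close> of them, so there are \<open>i\<close> in total.
\<close>

definition killed :: "nat \<Rightarrow> nat set" where
  "killed i = (\<Union>l<d. {b ^ l..<(digit i l + 1) * b ^ l})"

text \<open>
  The label of node \<open>k\<close>: the digits of \<open>k\<close> are continued by the lower digits of \<open>i\<close> up to the length of
  \<open>i\<close>, and the bit \<open>m\<close> is read off at the leaf reached in this way.
\<close>

definition heap :: "nat \<Rightarrow> nat \<Rightarrow> bit" where
  "heap i k = m (k * b ^ (len i - len k) + i mod b ^ (len i - len k))"

definition stored :: "nat \<Rightarrow> nat \<Rightarrow> bit" where
  "stored i p = (let r = b ^ (len i - 1) in if p \<in> {r..<2 * r} then heap i (p - r) else 0)"

text \<open>
  The label of node \<open>k\<close> as a function of the variables: an inner node is stored in the block that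
  starts at \<open>b ^ j\<close>, a leaf is the constant \<open>m k\<close>.
\<close>

definition heap_var :: "(var \<Rightarrow> bit) \<Rightarrow> nat \<Rightarrow> nat \<Rightarrow> bit" where
  "heap_var w j k = (if k < b ^ j then w (X (b ^ j + k)) else m k)"

text \<open>
  The root is node \<open>0\<close>, and the nodes with \<open>l\<close> digits form level \<open>l\<close>; the digit of the encoded number that
  chooses among their children is the one at position \<open>j - l\<close>. The number \<open>0\<close> is not a child of
  the root, because a leading digit is positive; this is why the sum omits it.
\<close>

definition heap_eqs :: "(var \<Rightarrow> bit) \<Rightarrow> bool" where
  "heap_eqs w \<longleftrightarrow>
     (\<forall>j\<in>{..<d}. \<forall>k\<in>{..<b ^ j}. sel w j * w (X (b ^ j + k)) =
        (\<Sum>c\<in>{c. c < b \<and> k * b + c \<noteq> 0}. w (Z j (j - len k) c) * heap_var w j (k * b + c))) \<and>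
     (\<forall>j\<in>{..<d}. sel w j * w (X (b ^ j)) = sel w j)"

text \<open>
  The block \<open>{b ^ j..<2 * b ^ j}\<close> is excepted: if the family \<open>j\<close> is selected, it holds the heap.
\<close>

definition kill_eqs :: "(var \<Rightarrow> bit) \<Rightarrow> bool" where
  "kill_eqs w \<longleftrightarrow>
     (\<forall>j\<in>{..<d}. \<forall>l\<in>{..<d}. \<forall>c\<in>{..<b}. \<forall>p\<in>{b ^ l..<(c + 1) * b ^ l} - {b ^ j..<2 * b ^ j}.
        w (Z j l c) * w (X p) = 0)"

text \<open>
  Both sides read the same leaf: the first digit by which the path continues below \<open>k\<close> is
  the digit of \<open>i\<close> at position \<open>j - len k\<close>.
\<close>

lemma heap_child:
  assumes "len i = Suc j" "k < b ^ j"
  shows "heap i k = heap i (k * b + digit i (j - len k))" "k * b + digit i (j - len k) \<noteq> 0"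
proof -
  have "len k \<le> j" using assms(2) base by (intro floorlog_leI) auto
  show nonzero: "k * b + digit i (j - len k) \<noteq> 0"
  proof (cases "k = 0")
    case True
    have "len 0 = 0" by (simp add: floorlog_eq_zero_iff)
    then show ?thesis using lead_digit[OF assms(1)] True by simp
  qed (use base in simp)
  define e where "e = j - len k"
  have len: "len i - len k = Suc e" "len i - len (k * b + digit i e) = e"
    using \<open>len k \<le> j\<close> assms(1) len_child[OF digit_less nonzero] by (simp_all add: e_def)
  have "i mod (b ^ e * b) = b ^ e * (i div b ^ e mod b) + i mod b ^ e" by (rule mod_mult2_eq)
  then have "k * b ^ Suc e + i mod b ^ Suc e = (k * b + digit i e) * b ^ e + i mod b ^ e"
    by (simp add: digit_def algebra_simps)
  then show "heap i k = heap i (k * b + digit i (j - len k))"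
    using len unfolding heap_def by (simp add: e_def)
qed

lemma heap_leaf:
  assumes "len i = Suc j" "b ^ j \<le> k" "k < b ^ Suc j"
  shows "heap i k = m k"
  using assms len_eqI[of j k] by (simp add: heap_def)

lemma heap_root:
  assumes "len i = Suc j"
  shows "heap i 0 = m i"
proof -
  have "len 0 = 0" by (simp add: floorlog_eq_zero_iff)
  then show ?thesis using len_bounds(2)[OF assms] assms by (simp add: heap_def)
qed

lemma child_less:
  assumes "k < b ^ j" "c < b"
  shows "k * b + c < b ^ Suc j"
proof -
  have "k * b + c < (k + 1) * b" using assms(2) by simp
  also have "\<dots> \<le> b ^ j * b" using assms(1) by (intro mult_le_mono1) simp
  finally show ?thesis by (simp add: mult.commute)
qed

lemma heap_eqs_sum:
  assumes "encodes w i" "len i = Suc j" "j < d" "k < b ^ j"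
  shows "(\<Sum>c\<in>{c. c < b \<and> k * b + c \<noteq> 0}. w (Z j (j - len k) c) * heap_var w j (k * b + c))
    = heap_var w j (k * b + digit i (j - len k))"
proof -
  let ?c = "digit i (j - len k)"
  have code: "w (Z j (j - len k) c) = of_bool (c = ?c)" if "c < b" for c
    using assms(1-3) that unfolding encodes_def by simp
  have "(\<Sum>c\<in>{c. c < b \<and> k * b + c \<noteq> 0}. w (Z j (j - len k) c) * heap_var w j (k * b + c))
    = (\<Sum>c\<in>{?c}. w (Z j (j - len k) c) * heap_var w j (k * b + c))"
    using heap_child(2)[OF assms(2,4)] digit_less by (intro sum.mono_neutral_right) (auto simp: code)
  then show ?thesis by (simp add: code digit_less)
qed

text \<open>
  Given the code of \<open>i\<close>, the equations become the recursion by which \<open>heap i\<close> descends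
  along the digits of \<open>i\<close>. A child has a larger number than its parent, so the recursion, with
  its values at the leaves, determines all labels, and the label of the root is \<open>m i\<close>.
\<close>

lemma heap_eqs_iff:
  assumes "encodes w i" "len i = Suc j" "j < d"
  shows "heap_eqs w \<longleftrightarrow> m i = 1 \<and> (\<forall>k<b ^ j. w (X (b ^ j + k)) = heap i k)"
proof -
  have sel: "sel w j' = of_bool (j' = j)" if "j' < d" for j'
    using encodes_sel[OF assms(1) that] assms(2) by auto
  have pos: "0 < b ^ j" using base by simp
  have "heap_eqs w \<longleftrightarrow> (\<forall>k<b ^ j. w (X (b ^ j + k)) = heap_var w j (k * b + digit i (j - len k)))
      \<and> w (X (b ^ j)) = 1" (is "_ \<longleftrightarrow> ?rec \<and> ?top")
  proof
    assume eqs: "heap_eqs w"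
    show "?rec \<and> ?top"
    proof (intro conjI allI impI)
      fix k assume k: "k < b ^ j"
      then have "sel w j * w (X (b ^ j + k)) =
          (\<Sum>c\<in>{c. c < b \<and> k * b + c \<noteq> 0}. w (Z j (j - len k) c) * heap_var w j (k * b + c))"
        using eqs assms(3) unfolding heap_eqs_def by blast
      then show "w (X (b ^ j + k)) = heap_var w j (k * b + digit i (j - len k))"
        by (simp only: heap_eqs_sum[OF assms k] sel[OF assms(3)] of_bool_eq mult_1_left simp_thms)
    next
      have "sel w j * w (X (b ^ j)) = sel w j"
        using eqs assms(3) unfolding heap_eqs_def by blast
      then show "w (X (b ^ j)) = 1" by (simp add: sel[OF assms(3)])
    qed
  next
    assume rec: "?rec \<and> ?top"
    show "heap_eqs w" unfolding heap_eqs_def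
    proof (intro conjI ballI)
      fix j' k assume "j' \<in> {..<d}" "k \<in> {..<b ^ j'}"
      then have j': "j' < d" and k: "k < b ^ j'" by simp_all
      show "sel w j' * w (X (b ^ j' + k)) = (\<Sum>c\<in>{c. c < b \<and> k * b + c \<noteq> 0}.
          w (Z j' (j' - len k) c) * heap_var w j' (k * b + c))"
      proof (cases "j' = j")
        case True
        then show ?thesis using heap_eqs_sum[OF assms, of k] rec k sel[OF assms(3)] by simp
      next
        case False
        have "w (Z j' (j' - len k) c) = 0" if "c < b" for c
          using False assms(1,2) j' that unfolding encodes_def by simp
        then have "(\<Sum>c\<in>{c. c < b \<and> k * b + c \<noteq> 0}.
          w (Z j' (j' - len k) c) * heap_var w j' (k * b + c)) = 0" by (intro sum.neutral) simp
        then show ?thesis using False sel[OF j'] by simp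
      qed
    next
      fix j' assume "j' \<in> {..<d}"
      then show "sel w j' * w (X (b ^ j')) = sel w j'"
        using rec sel[of j'] by (cases "j' = j") simp_all
    qed
  qed
  also have "\<dots> \<longleftrightarrow> m i = 1 \<and> (\<forall>k<b ^ j. w (X (b ^ j + k)) = heap i k)"
  proof
    assume rec: "?rec \<and> ?top"
    \<comment> \<open>From the leaves to the root: the labels are known for all numbers larger than \<open>k\<close>.\<close>
    have all: "heap_var w j k = heap i k" if "k < b ^ Suc j" for k
      using that
    proof (induction "b ^ Suc j - k" arbitrary: k rule: less_induct)
      case less
      show ?case
      proof (cases "k < b ^ j")
        case False
        then show ?thesis using heap_leaf[OF assms(2), of k] less.prems by (simp add: heap_var_def)
      next
        case True
        let ?k = "k * b + digit i (j - len k)"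
        have less': "?k < b ^ Suc j" by (rule child_less[OF True digit_less])
        have "k < ?k"
        proof (cases "k = 0")
          case False
          then have "k * 1 < k * b" using base by (intro mult_less_mono2) auto
          then show ?thesis by linarith
        qed (use heap_child(2)[OF assms(2) True] in simp)
        then have "heap_var w j ?k = heap i ?k"
          using less.hyps[of ?k] less' less.prems by linarith
        moreover have "heap_var w j k = heap_var w j ?k"
          using rec True by (simp add: heap_var_def)
        ultimately show ?thesis using heap_child(1)[OF assms(2) True] by simp
      qed
    qed
    have "w (X (b ^ j + k)) = heap i k" if "k < b ^ j" for k
    proof -
      have "b ^ j \<le> b ^ Suc j" using base by (intro power_increasing) auto
      with that have "k < b ^ Suc j" by linarith
      then show ?thesis using all[of k] that by (simp add: heap_var_def)
    qed
    moreover from this[of 0] have "m i = 1" using rec pos heap_root[OF assms(2)] by simp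
    ultimately show "m i = 1 \<and> (\<forall>k<b ^ j. w (X (b ^ j + k)) = heap i k)" by blast
  next
    assume heap: "m i = 1 \<and> (\<forall>k<b ^ j. w (X (b ^ j + k)) = heap i k)"
    have "heap_var w j k = heap i k" if "k < b ^ Suc j" for k
      using heap heap_leaf[OF assms(2), of k] that by (simp add: heap_var_def not_less)
    then have "heap_var w j (k * b + digit i (j - len k)) = heap i k" if "k < b ^ j" for k
      using heap_child(1)[OF assms(2) that] child_less[OF that digit_less] by metis
    moreover have "w (X (b ^ j)) = 1"
      using heap pos heap_root[OF assms(2)] by (metis add_0_right)
    ultimately show "?rec \<and> ?top" using heap by simp
  qed
  finally show ?thesis .
qed

text \<open>
  There is room for the heap because the leading digit is at least one.
\<close>

lemma killed_block:
  assumes "len i = Suc j" "j < d"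
  shows "{b ^ j..<2 * b ^ j} \<subseteq> killed i"
proof -
  have "2 * b ^ j \<le> (digit i j + 1) * b ^ j"
    using lead_digit[OF assms(1)] by (intro mult_le_mono1) simp
  then have "{b ^ j..<2 * b ^ j} \<subseteq> {b ^ j..<(digit i j + 1) * b ^ j}" by simp
  also have "\<dots> \<subseteq> killed i" using assms(2) unfolding killed_def by (intro UN_upper) simp
  finally show ?thesis .
qed

lemma kill_eqs_iff:
  assumes "encodes w i" "len i = Suc j" "j < d"
  shows "kill_eqs w \<longleftrightarrow> (\<forall>p\<in>killed i - {b ^ j..<2 * b ^ j}. w (X p) = 0)"
proof -
  have code: "w (Z j' l c) = of_bool (j' = j \<and> c = digit i l)" if "j' < d" "l < d" "c < b" for j' l c
    using assms(1,2) that unfolding encodes_def by auto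
  show ?thesis
  proof
    assume eqs: "kill_eqs w"
    show "\<forall>p\<in>killed i - {b ^ j..<2 * b ^ j}. w (X p) = 0"
    proof
      fix p assume "p \<in> killed i - {b ^ j..<2 * b ^ j}"
      then obtain l where l: "l < d" "p \<in> {b ^ l..<(digit i l + 1) * b ^ l} - {b ^ j..<2 * b ^ j}"
        unfolding killed_def by blast
      then have "w (Z j l (digit i l)) * w (X p) = 0"
        using eqs assms(3) digit_less unfolding kill_eqs_def by blast
      then show "w (X p) = 0" using code[OF assms(3) l(1) digit_less] by simp
    qed
  next
    assume zero: "\<forall>p\<in>killed i - {b ^ j..<2 * b ^ j}. w (X p) = 0"
    show "kill_eqs w" unfolding kill_eqs_def
    proof (intro ballI)
      fix j' l c p
      assume *: "j' \<in> {..<d}" "l \<in> {..<d}" "c \<in> {..<b}"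
        "p \<in> {b ^ l..<(c + 1) * b ^ l} - {b ^ j'..<2 * b ^ j'}"
      show "w (Z j' l c) * w (X p) = 0"
      proof (cases "j' = j \<and> c = digit i l")
        case True
        then have "p \<in> killed i - {b ^ j..<2 * b ^ j}" using * unfolding killed_def by blast
        then show ?thesis using zero by simp
      next
        case False
        then show ?thesis using code * by simp
      qed
    qed
  qed
qed

definition cube :: "nat \<Rightarrow> (var \<Rightarrow> bit) set" where
  "cube i = {w. (\<forall>v. v \<notin> vars \<longrightarrow> w v = 0) \<and> encodes w i \<and> (\<forall>p\<in>killed i. w (X p) = stored i p)}"

definition solutions :: "(var \<Rightarrow> bit) set" where
  "solutions = {w. (\<forall>v\<in>-vars. w v = 0) \<and> code_eqs w \<and> heap_eqs w \<and> kill_eqs w}"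

lemma solutions_eq: "solutions = (\<Union>i\<in>{i \<in> {1..<b ^ d}. m i = 1}. cube i)"
proof -
  have *: "heap_eqs w \<and> kill_eqs w \<longleftrightarrow> m i = 1 \<and> (\<forall>p\<in>killed i. w (X p) = stored i p)"
    if i: "i \<in> {1..<b ^ d}" and enc: "encodes w i" for w i
  proof -
    obtain j where j: "j < d" "len i = Suc j" using len_cases[OF i] .
    have "(\<forall>k<b ^ j. w (X (b ^ j + k)) = heap i k) \<longleftrightarrow>
      (\<forall>p\<in>{b ^ j..<2 * b ^ j}. w (X p) = stored i p)"
    proof
      assume L: "\<forall>k<b ^ j. w (X (b ^ j + k)) = heap i k"
      show "\<forall>p\<in>{b ^ j..<2 * b ^ j}. w (X p) = stored i p"
      proof
        fix p assume p: "p \<in> {b ^ j..<2 * b ^ j}"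
        then have "p - b ^ j < b ^ j" "b ^ j + (p - b ^ j) = p" by auto
        then show "w (X p) = stored i p" using L[rule_format, of "p - b ^ j"] p
          by (simp add: stored_def j(2))
      qed
    next
      assume R: "\<forall>p\<in>{b ^ j..<2 * b ^ j}. w (X p) = stored i p"
      show "\<forall>k<b ^ j. w (X (b ^ j + k)) = heap i k"
      proof (intro allI impI)
        fix k assume "k < b ^ j"
        then show "w (X (b ^ j + k)) = heap i k" using R[rule_format, of "b ^ j + k"]
          by (simp add: stored_def j(2))
      qed
    qed
    moreover have "(\<forall>p\<in>killed i - {b ^ j..<2 * b ^ j}. w (X p) = 0) \<longleftrightarrow>
      (\<forall>p\<in>killed i - {b ^ j..<2 * b ^ j}. w (X p) = stored i p)"
      by (intro ball_cong) (auto simp: stored_def j(2) Let_def)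
    ultimately show ?thesis
      using heap_eqs_iff[OF enc j(2,1)] kill_eqs_iff[OF enc j(2,1)] killed_block[OF j(2,1)] by blast
  qed
  show ?thesis
  proof (intro set_eqI)
    fix w
    have "w \<in> solutions \<longleftrightarrow> (\<forall>v. v \<notin> vars \<longrightarrow> w v = 0) \<and>
        (\<exists>i\<in>{1..<b ^ d}. encodes w i \<and> heap_eqs w \<and> kill_eqs w)"
      unfolding solutions_def code_eqs_iff by blast
    also have "\<dots> \<longleftrightarrow> w \<in> (\<Union>i\<in>{i \<in> {1..<b ^ d}. m i = 1}. cube i)"
      using * unfolding cube_def by blast
    finally show "w \<in> solutions \<longleftrightarrow> w \<in> (\<Union>i\<in>{i \<in> {1..<b ^ d}. m i = 1}. cube i)" .
  qed
qed

text \<open>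
  Every equation is a sum of products of two affine functions. The children that are leaves enter as the
  constants \<open>m k\<close>, and this is where the arbitrary bits are put into the system.
\<close>

lemma quadric_solutions: "quadric solutions"
proof -
  have sel: "affine_fun (\<lambda>w. sel w j)" for j
    unfolding sel_def by (intro affine_fun_sum affine_fun_coord)
  have heap_var: "affine_fun (\<lambda>w. heap_var w j k)" for j k
    unfolding heap_var_def by (cases "k < b ^ j") (simp_all add: affine_fun_coord affine_fun_const)
  show ?thesis
    unfolding solutions_def code_eqs_def heap_eqs_def kill_eqs_def
    by (intro quadric_conj quadric_ALL quadric_eq)
      (rule quadratic_sum quadratic_mult | rule quadratic_affine
        | rule affine_fun_coord affine_fun_const sel heap_var)+
qed

section \<open>The number of solutions\<close>

lemma card_killed:
  assumes "i < b ^ d"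
  shows "card (killed i) = i"
proof -
  have bound: "{b ^ l..<(digit i l + 1) * b ^ l} \<subseteq> {b ^ l..<b ^ Suc l}" for l
  proof -
    have "(digit i l + 1) * b ^ l \<le> b * b ^ l" using digit_less[of i l] by (intro mult_le_mono1) simp
    then show ?thesis by auto
  qed
  \<comment> \<open>The indices in the \<open>l\<close>-th block have their leading digit at position \<open>l\<close>.\<close>
  have disj: "{b ^ l..<b ^ Suc l} \<inter> {b ^ l'..<b ^ Suc l'} = {}" if "l < l'" for l l'
  proof -
    have "b ^ Suc l \<le> b ^ l'" using that base by (intro power_increasing) auto
    then show ?thesis by auto
  qed
  have "card (killed i) = (\<Sum>l<d. card {b ^ l..<(digit i l + 1) * b ^ l})"
    unfolding killed_def
  proof (intro card_UN_disjoint ballI impI)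
    fix l l' :: nat assume "l \<noteq> l'"
    then have "{b ^ l..<b ^ Suc l} \<inter> {b ^ l'..<b ^ Suc l'} = {}"
      using disj[of l l'] disj[of l' l] by (metis Int_commute linorder_neqE_nat)
    then show "{b ^ l..<(digit i l + 1) * b ^ l} \<inter> {b ^ l'..<(digit i l' + 1) * b ^ l'} = {}"
      using bound[of l] bound[of l'] by blast
  qed simp_all
  also have "\<dots> = (\<Sum>l<d. digit i l * b ^ l)" by (intro sum.cong) simp_all
  finally show ?thesis using assms by (simp add: sum_digits)
qed

lemma killed_subset: "killed i \<subseteq> {1..<b ^ d}"
proof
  fix p assume "p \<in> killed i"
  then obtain l where l: "l < d" "b ^ l \<le> p" "p < (digit i l + 1) * b ^ l"
    unfolding killed_def by auto
  note l(3)
  also have "(digit i l + 1) * b ^ l \<le> b * b ^ l" using digit_less[of i l] by (intro mult_le_mono1) simp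
  also have "b * b ^ l \<le> b ^ d"
    using power_increasing[of "Suc l" d b] l(1) base by simp
  finally have "p < b ^ d" .
  moreover have "1 \<le> b ^ l" using base by simp
  ultimately show "p \<in> {1..<b ^ d}" using l(2) by simp
qed

lemma card_cube:
  assumes "i \<in> {1..<b ^ d}"
  shows "card (cube i) = 2 ^ (b ^ d - 1 - i)"
proof -
  let ?Z = "(\<lambda>(j, t, c). Z j t c) ` ({..<d} \<times> {..<d} \<times> {..<b})"
  define g where "g v = (case v of X p \<Rightarrow> stored i p
    | Z j t c \<Rightarrow> of_bool (len i = Suc j \<and> c = digit i t))" for v
  have "cube i = {w. (\<forall>v. v \<notin> vars \<longrightarrow> w v = 0) \<and> (\<forall>v\<in>?Z \<union> X ` killed i. w v = g v)}"
    unfolding cube_def encodes_def by (auto simp: g_def ball_Un)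
  moreover have "?Z \<union> X ` killed i \<subseteq> vars" using killed_subset unfolding vars_def by blast
  ultimately have "card (cube i) = 2 ^ (card vars - card (?Z \<union> X ` killed i))"
    using card_subcube[OF finite_vars] by simp
  moreover have "card (?Z \<union> X ` killed i) = d * (d * b) + i"
  proof -
    have "finite (killed i)" using killed_subset finite_subset by blast
    moreover have "card (X ` killed i) = i"
      using assms by (subst card_image) (auto simp: inj_on_def card_killed)
    ultimately show ?thesis by (subst card_Un_disjoint) (auto simp: card_code_vars)
  qed
  ultimately show ?thesis by (simp add: card_vars)
qed

lemma card_solutions: "card solutions = (\<Sum>i\<in>{i \<in> {1..<b ^ d}. m i = 1}. 2 ^ (b ^ d - 1 - i))"
proof -
  have "card solutions = (\<Sum>i\<in>{i \<in> {1..<b ^ d}. m i = 1}. card (cube i))"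
    unfolding solutions_eq
  proof (intro card_UN_disjoint ballI impI)
    show "finite (cube i)" if "i \<in> {i \<in> {1..<b ^ d}. m i = 1}" for i
      using that by (intro card_ge_0_finite) (simp add: card_cube)
    show "cube i \<inter> cube i' = {}"
      if "i \<in> {i \<in> {1..<b ^ d}. m i = 1}" "i' \<in> {i \<in> {1..<b ^ d}. m i = 1}" "i \<noteq> i'" for i i'
      using that encodes_inj unfolding cube_def by blast
  qed simp
  then show ?thesis by (simp add: card_cube)
qed

text \<open>
  The exponents of two in the number of solutions.
\<close>

definition bit_set :: "nat set" where
  "bit_set = (\<lambda>i. b ^ d - 1 - i) ` {i \<in> {1..<b ^ d}. m i = 1}"

lemma size_not_in_Sp: "2 ^ card vars - set_encode bit_set \<notin> Sp (card vars) 3 1"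
proof -
  have "inj_on (\<lambda>i. b ^ d - 1 - i) {i \<in> {1..<b ^ d}. m i = 1}"
    by (auto simp: inj_on_def)
  then have "set_encode bit_set = card solutions"
    by (simp add: set_encode_def bit_set_def card_solutions sum.reindex)
  moreover have "solutions \<subseteq> {w. \<forall>v. v \<notin> vars \<longrightarrow> w v = 0}"
    unfolding solutions_def by blast
  ultimately show ?thesis
    using not_in_Sp[OF finite_vars refl quadric_solutions] by simp
qed

end

section \<open>The spectrum\<close>

lemma set_encode_less:
  assumes "A \<subseteq> {..<n}"
  shows "set_encode A < 2 ^ n"
proof -
  have "set_encode A \<le> (\<Sum>i<n. 2 ^ i)"
    unfolding set_encode_def using assms by (intro sum_mono2) auto
  also have "\<dots> < 2 ^ n" by (simp add: mask_eq_sum_exp_nat[symmetric] lessThan_def)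
  finally show ?thesis .
qed

text \<open>
  A set \<open>A\<close> of exponents below \<open>b ^ d - 1\<close> is realised by taking \<open>m\<close> as its reversed indicator
  function. Binary expansions are unique, so different sets \<open>A\<close> exclude different sizes.
\<close>

lemma card_Sp_le:
  assumes "2 \<le> b" "n = b ^ d - 1 + d * (d * b)"
  shows "card (Sp n 3 1) + 2 ^ (b ^ d - 1) \<le> 2 ^ n + 1"
proof -
  let ?k = "b ^ d - 1"
  have not_in: "2 ^ n - set_encode A \<notin> Sp n 3 1" if "A \<subseteq> {..<?k}" for A
  proof -
    \<comment> \<open>\<open>?k - i\<close> is the exponent of the piece for the index \<open>i\<close>.\<close>
    define m :: "nat \<Rightarrow> bit" where "m i = of_bool (?k - i \<in> A)" for i
    interpret comparator b d m by unfold_locales (fact assms(1))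
    have "bit_set = A"
    proof
      show "bit_set \<subseteq> A" by (auto simp: bit_set_def m_def)
      show "A \<subseteq> bit_set"
      proof
        fix a assume "a \<in> A"
        with that have "a < ?k" by blast
        then have "?k - a \<in> {1..<b ^ d}" "?k - (?k - a) = a" by auto
        with \<open>a \<in> A\<close> show "a \<in> bit_set"
          unfolding bit_set_def by (intro image_eqI[of _ _ "?k - a"]) (simp_all add: m_def)
      qed
    qed
    then show ?thesis using size_not_in_Sp by (simp add: card_vars assms(2))
  qed
  define M where "M = (\<lambda>A. 2 ^ n - set_encode A) ` Pow {..<?k}"
  have le: "set_encode A \<le> 2 ^ n" if "A \<subseteq> {..<?k}" for A
  proof -
    have "set_encode A < 2 ^ ?k" using that by (rule set_encode_less)
    also have "\<dots> \<le> 2 ^ n" using assms(2) by (intro power_increasing) auto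
    finally show ?thesis by simp
  qed
  have "inj_on (\<lambda>A. 2 ^ n - set_encode A) (Pow {..<?k})"
  proof (intro inj_onI)
    fix A B assume AB: "A \<in> Pow {..<?k}" "B \<in> Pow {..<?k}" "2 ^ n - set_encode A = 2 ^ n - set_encode B"
    then have "set_encode A = set_encode B" using le[of A] le[of B] by simp
    moreover have "finite A" "finite B" using AB finite_subset by blast+
    ultimately show "A = B" by (simp add: set_encode_eq)
  qed
  then have "card M = 2 ^ ?k" by (simp add: M_def card_image card_Pow)
  moreover have sub: "Sp n 3 1 \<union> M \<subseteq> {..2 ^ n}" by (auto simp: Sp_def M_def)
  moreover have "card (Sp n 3 1 \<union> M) = card (Sp n 3 1) + card M"
    using not_in finite_subset[OF sub] by (intro card_Un_disjoint) (auto simp: M_def)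
  moreover have "card (Sp n 3 1 \<union> M) \<le> card {..2 ^ n :: nat}"
    by (intro card_mono sub) simp
  ultimately show ?thesis by simp
qed

text \<open>
  This is the case \<open>b = 2 ^ s\<close>, \<open>d = s\<close>. The loss is the number of code variables plus one; the
  additional one absorbs the difference between the \<open>2 ^ n + 1\<close> candidates \<open>0, \<dots>, 2 ^ n\<close> and
  \<open>2 ^ n\<close>. As \<open>n \<ge> 2 ^ (s * s)\<close>, the square root of \<open>log 2 n\<close> is at least \<open>s\<close>, so the given
  \<open>e\<close> makes \<open>2 powr ((1 + e) * sqrt (log 2 n))\<close> at least as large as the loss.
\<close>

lemma card_Sp_le_powr:
  fixes s n :: nat
  assumes s: "1 \<le> s" and n: "n = 2 ^ (s * s) - 1 + s * (s * 2 ^ s)"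
    and e: "e = log 2 (real s * (real s * 2 ^ s) + 1) / real s - 1"
  shows "real (card (Sp n 3 1)) \<le>
    2 ^ n - 2 powr (real n - 2 powr ((1 + e) * sqrt (log 2 (real n))))"
proof -
  define loss where "loss = real s * (real s * 2 ^ s) + 1"
  let ?k = "2 ^ (s * s) - 1 :: nat"
  have loss: "1 \<le> loss" by (simp add: loss_def)
  have "2 ^ 1 \<le> (2 ^ (s * s) :: nat)" using s by (intro power_increasing) auto
  then have k: "1 \<le> ?k" by simp
  have "1 \<le> s * (s * 2 ^ s)" using s by simp
  then have "2 ^ (s * s) \<le> n" using n by linarith
  then have pow_le: "2 ^ (s * s) \<le> real n" by (metis of_nat_le_iff of_nat_numeral of_nat_power)
  have "real s ^ 2 = log 2 (2 ^ (s * s))" by (simp add: log_nat_power power2_eq_square)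
  also have "\<dots> \<le> log 2 (real n)" using pow_le by (intro log_mono) auto
  finally have sqrt: "real s \<le> sqrt (log 2 (real n))" by (rule real_le_rsqrt)
  have e': "1 + e = log 2 loss / real s" by (simp add: e loss_def)
  then have "0 \<le> 1 + e" using loss by simp
  have "log 2 loss = (1 + e) * real s" using s by (simp add: e')
  also have "\<dots> \<le> (1 + e) * sqrt (log 2 (real n))"
    using sqrt \<open>0 \<le> 1 + e\<close> by (intro mult_left_mono)
  finally have "2 powr log 2 loss \<le> 2 powr ((1 + e) * sqrt (log 2 (real n)))"
    by (intro powr_mono) auto
  then have loss_le: "loss \<le> 2 powr ((1 + e) * sqrt (log 2 (real n)))" using loss by simp
  have "loss - 1 = real (s * (s * 2 ^ s))" by (simp add: loss_def)
  then have "real n = real ?k + (loss - 1)" by (simp only: n of_nat_add)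
  then have "2 powr (real n - 2 powr ((1 + e) * sqrt (log 2 (real n)))) \<le> 2 powr (real ?k - 1)"
    using loss_le by (intro powr_mono) linarith+
  also have "\<dots> = 2 ^ ?k / 2" by (simp only: powr_diff powr_realpow zero_less_numeral powr_one)
  also have "\<dots> \<le> 2 ^ ?k - 1"
  proof -
    have "(2 :: real) ^ 1 \<le> 2 ^ ?k" using k by (intro power_increasing) auto
    then show ?thesis by simp
  qed
  finally have powr_le: "2 powr (real n - 2 powr ((1 + e) * sqrt (log 2 (real n)))) \<le> 2 ^ ?k - 1" .
  have "2 ^ 1 \<le> (2 ^ s :: nat)" using s by (intro power_increasing) auto
  then have "card (Sp n 3 1) + 2 ^ ((2 ^ s) ^ s - 1) \<le> 2 ^ n + 1"
    by (intro card_Sp_le) (simp_all only: n power_mult power_one_right)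
  then have "card (Sp n 3 1) + 2 ^ ?k \<le> 2 ^ n + 1" by (simp only: power_mult)
  then have "real (card (Sp n 3 1) + 2 ^ ?k) \<le> real (2 ^ n + 1)" by (simp only: of_nat_le_iff)
  then have "real (card (Sp n 3 1)) + 2 ^ ?k \<le> 2 ^ n + 1" by simp
  with powr_le show ?thesis by linarith
qed

text \<open>
  By monotonicity, the elements of the range beyond \<open>f D\<close> are the values of \<open>f\<close> beyond \<open>D\<close>.
\<close>

lemma tendsto_along_range:
  fixes f :: "nat \<Rightarrow> nat" and \<epsilon> :: "nat \<Rightarrow> real"
  assumes "strict_mono f" "(\<lambda>s. \<epsilon> (f s)) \<longlonglongrightarrow> l"
  shows "(\<epsilon> \<longlongrightarrow> l) (inf at_top (principal (range f)))"
proof (rule topological_tendstoI)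
  fix S :: "real set" assume "open S" "l \<in> S"
  then obtain D where D: "\<And>s. s \<ge> D \<Longrightarrow> \<epsilon> (f s) \<in> S"
    using topological_tendstoD[OF assms(2)] unfolding eventually_sequentially by blast
  have "\<forall>n\<ge>f D. n \<in> range f \<longrightarrow> \<epsilon> n \<in> S"
    using D strict_mono_less_eq[OF assms(1)] by blast
  then show "eventually (\<lambda>n. \<epsilon> n \<in> S) (inf at_top (principal (range f)))"
    unfolding eventually_inf_principal eventually_at_top_linorder by blast
qed

theorem theorem7p4:
  shows "\<exists>(N :: nat set) (\<epsilon> :: nat \<Rightarrow> real).
           infinite N \<and> (\<forall>n\<in>N. n > 0) \<and>
           (\<epsilon> \<longlongrightarrow> 0) (inf at_top (principal N)) \<and>
           (\<forall>n\<in>N. real (card (Sp n 3 1)) \<le>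
              2 ^ n - 2 powr (real n - 2 powr ((1 + \<epsilon> n) * sqrt (log 2 (real n)))))"
proof -
  \<comment> \<open>The parameter is \<open>s = Suc d\<close>, since the estimates divide by \<open>s\<close>.\<close>
  define dim :: "nat \<Rightarrow> nat" where
    "dim d = (let s = Suc d in 2 ^ (s * s) - 1 + s * (s * 2 ^ s))" for d
  define \<delta> :: "nat \<Rightarrow> real" where
    "\<delta> d = (let s = Suc d in log 2 (real s * (real s * 2 ^ s) + 1) / real s - 1)" for d
  have mono: "strict_mono dim"
    unfolding strict_mono_Suc_iff
  proof
    fix d
    have "(2 :: nat) ^ (Suc d * Suc d) \<le> 2 ^ (Suc (Suc d) * Suc (Suc d))"
      by (intro power_increasing mult_le_mono) auto
    moreover have "Suc d * (Suc d * 2 ^ Suc d) < Suc (Suc d) * (Suc (Suc d) * 2 ^ Suc (Suc d) :: nat)"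
      by (intro mult_less_le_imp_less mult_le_mono power_increasing) auto
    ultimately show "dim d < dim (Suc d)" unfolding dim_def Let_def by linarith
  qed
  define \<epsilon> where "\<epsilon> n = \<delta> (the_inv dim n)" for n
  have \<epsilon>: "\<epsilon> (dim d) = \<delta> d" for d
    using mono by (simp add: \<epsilon>_def the_inv_f_f strict_mono_imp_inj_on)
  have "(\<lambda>s. log 2 (real s * (real s * 2 ^ s) + 1) / real s - 1) \<longlonglongrightarrow> 0" by real_asymp
  then have "\<delta> \<longlonglongrightarrow> 0" unfolding \<delta>_def Let_def by (rule LIMSEQ_Suc)
  then have "(\<epsilon> \<longlongrightarrow> 0) (inf at_top (principal (range dim)))"
    using mono by (intro tendsto_along_range) (simp_all add: \<epsilon>)
  moreover have "infinite (range dim)"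
    using mono by (metis finite_imageD infinite_UNIV_nat strict_mono_imp_inj_on)
  moreover have "0 < dim d" for d
    unfolding dim_def Let_def by (rule trans_less_add2) simp
  moreover have "real (card (Sp (dim d) 3 1)) \<le>
      2 ^ dim d - 2 powr (real (dim d) - 2 powr ((1 + \<epsilon> (dim d)) * sqrt (log 2 (real (dim d)))))" for d
    unfolding \<epsilon> by (rule card_Sp_le_powr[of "Suc d"]) (simp_all add: dim_def \<delta>_def Let_def)
  ultimately show ?thesis by blast
qed

end
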